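(* When the system of balance laws is endowed with a mathematical entropy $\Phi$ (conditions (5) and (6) of the context, in addition to (1)-(4)), the effective equations take the form $$\partial_t u=\partial_x\Big(L(u)\,\partial_x\big(D_u\Phi(\mathcal{E}(u))\big)^T\Big),$$ where $$L(u):=S(u)\,\mathcal{L}(u)^{-1}S(u)^T,\qquad S(u):=Q\,A(\mathcal{E}(u)),\qquad \mathcal{L}(u):=\big(D_U^2\Phi\big)(\mathcal{E}(u))\,B(\mathcal{E}(u)),$$ and where, for all $b$ satisfying $Qb=0$, the unique solution $V$ to $$\mathcal{L}(u)V=b,\qquad QV=0$$ is denoted by $\mathcal{L}(u)^{-1}b$ (generalized inverse).
   Context: Let $\Omega\subset\mathbb{R}^N$ be convex and open, and let $F,R:\Omega\to\mathbb{R}^N$ be smooth. Write $A(U):=D_UF(U)$ and $B(U):=D_UR(U)$ ($N\times N$ matrices). $A(U)$ is assumed to have real eigenvalues and a basis of eigenvectors for every $U\in\Omega$. The system of balance laws is $\varepsilon\,\partial_tU+\partial_xF(U)=-R(U)/\varepsilon$, $t>0$, $x\in\mathbb{R}$. Assumptions: (1) $Q$ is an $n\times N$ matrix of rank $n<N$ with $QR(U)=0$ for all $U\in\Omega$; set $\omega:=Q\Omega\subset\mathbb{R}^n$. (2) There is a map $\mathcal{E}:\omega\to\Omega$ with $R(\mathcal{E}(u))=0$ and $Q\mathcal{E}(u)=u$ for all $u\in\omega$. The equilibrium manifold is the set of states $U=\mathcal{E}(u)$, $u\in\omega$. (3) $QF(\mathcal{E}(u))=0$ for all $u\in\omega$.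 (4) For all $u\in\omega$: $\dim\ker B(\mathcal{E}(u))=n$ and $\ker B(\mathcal{E}(u))\cap\operatorname{Im}B(\mathcal{E}(u))=\{0\}$. (5) (Entropy) There are functions $\Phi,\Psi:\Omega\to\mathbb{R}$ (entropy and entropy flux) such that $D_U\Phi\,A=D_U\Psi$ in $\Omega$; consequently $D_U^2\Phi\,A$ is symmetric in $\Omega$. In addition $\Phi$ is convex, in the sense that the $N\times N$ matrix $D_U^2\Phi$ is positive definite on the equilibrium manifold. (6) (Compatibility with the relaxation) $D_U\Phi\,R\ge0$ in $\Omega$, and $D_U\Phi(U)=\nu(U)Q\in\mathbb{R}^N$ with $\nu(U)\in\mathbb{R}^n$. The effective equations, obtained formally as $\varepsilon\to0$ from the expansion $U^\varepsilon=\mathcal{E}(u)+\varepsilon U_1+\varepsilon^2U_2+\dots$ with $u=QU^\varepsilon$, are $\partial_tu=-\partial_x\big(Q\,A(\mathcal{E}(u))\,U_1\big)$, where $U_1$ is the unique solution to $B(\mathcal{E}(u))U_1=-\partial_x\big(F(\mathcal{E}(u))\big)$, $QU_1=0$. Derivatives such as $D_U\Phi$ are row vectors; $D_u\Phi(\mathcal{E}(u))$ denotes the derivative with respect to $u$ of the composite $u\mapsto\Phi(\mathcal{E}(u))$.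
   Formalization: Unique solvability of 𝓛(u)V=b, QV=0 is asserted exactly when Q(D²Φ(E(u)))⁻¹b=0 (in particular for b in the range of S(u)ᵀ), not for all b with Qb=0, which fails in general; D_UΦ=νQ is required only on the equilibrium manifold, since on all of Ω it contradicts (5). *)

theory Defs
  imports "HOL-Analysis.Analysis"
begin

text \<open>
  Matrices with \<open>n\<close> rows and \<open>N\<close> columns have type \<open>real^'N^'n\<close>. Row vectors such as
  \<open>D\<^sub>U\<Phi>\<close> and their transposes are both elements of \<open>real^'N\<close>; the product of a row vector
  with a matrix is \<open>v*\<close>.
\<close>

text \<open>\<open>C\<^sup>k\<close> regularity; intended for open \<open>S\<close>.\<close>

primrec Ck_on :: "nat \<Rightarrow> ('a::real_normed_vector \<Rightarrow> 'b::real_normed_vector) \<Rightarrow> 'a set \<Rightarrow> bool"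
where
  "Ck_on 0 f S \<longleftrightarrow> continuous_on S f"
| "Ck_on (Suc k) f S \<longleftrightarrow>
     f differentiable_on S \<and> (\<forall>v. Ck_on k (\<lambda>x. frechet_derivative f (at x) v) S)"

definition smooth_on :: "('a::real_normed_vector \<Rightarrow> 'b::real_normed_vector) \<Rightarrow> 'a set \<Rightarrow> bool"
  where "smooth_on f S \<longleftrightarrow> (\<forall>k. Ck_on k f S)"

definition grad :: "(real^'m \<Rightarrow> real) \<Rightarrow> real^'m \<Rightarrow> real^'m"
  where "grad f x = (\<chi> i. frechet_derivative f (at x) (axis i 1))"

definition hessian :: "(real^'m \<Rightarrow> real) \<Rightarrow> real^'m \<Rightarrow> real^'m^'m"
  where "hessian f x = jacobian (grad f) (at x)"

definition has_real_eigenbasis :: "real^'m^'m \<Rightarrow> bool"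
  where "has_real_eigenbasis A \<longleftrightarrow>
    (\<exists>V. independent V \<and> span V = UNIV \<and> (\<forall>v\<in>V. \<exists>\<mu>. A *v v = \<mu> *\<^sub>R v))"

definition pos_definite :: "real^'m^'m \<Rightarrow> bool"
  where "pos_definite H \<longleftrightarrow> transpose H = H \<and> (\<forall>V. V \<noteq> 0 \<longrightarrow> V \<bullet> (H *v V) > 0)"

definition solves_constrained :: "real^'N^'n \<Rightarrow> real^'N^'N \<Rightarrow> real^'N \<Rightarrow> real^'N \<Rightarrow> bool"
  where "solves_constrained Q M b V \<longleftrightarrow> M *v V = b \<and> Q *v V = 0"

text \<open>Generalized inverse, applied to a vector and (columnwise) to a matrix. It is meaningful
  only for those right-hand sides for which the constrained problem is uniquely solvable. With
  \<open>H\<close> the Hessian of the entropy and \<open>M = H B\<close>, these are the \<open>b\<close> with \<open>Q H\<^sup>-\<^sup>1 b = 0\<close>; this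
  subspace differs from the kernel of \<open>Q\<close> unless \<open>H\<close> maps that kernel to itself.\<close>

definition gen_inv :: "real^'N^'n \<Rightarrow> real^'N^'N \<Rightarrow> real^'N \<Rightarrow> real^'N"
  where "gen_inv Q M b = (THE V. solves_constrained Q M b V)"

definition gen_inv_matrix :: "real^'N^'n \<Rightarrow> real^'N^'N \<Rightarrow> real^'k^'N \<Rightarrow> real^'k^'N"
  where "gen_inv_matrix Q M X = (\<chi> i j. gen_inv Q M (column j X) $ i)"

text \<open>The matrices \<open>S(u)\<close>, \<open>\<L>(u)\<close>, \<open>L(u)\<close>.\<close>

definition S_mat :: "(real^'N \<Rightarrow> real^'N) \<Rightarrow> real^'N^'n \<Rightarrow> (real^'n \<Rightarrow> real^'N) \<Rightarrow>
    real^'n \<Rightarrow> real^'N^'n"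
  where "S_mat F Q E u = Q ** jacobian F (at (E u))"

definition calL_mat :: "(real^'N \<Rightarrow> real^'N) \<Rightarrow> (real^'N \<Rightarrow> real) \<Rightarrow> (real^'n \<Rightarrow> real^'N) \<Rightarrow>
    real^'n \<Rightarrow> real^'N^'N"
  where "calL_mat R \<Phi> E u = hessian \<Phi> (E u) ** jacobian R (at (E u))"

definition L_mat :: "(real^'N \<Rightarrow> real^'N) \<Rightarrow> (real^'N \<Rightarrow> real^'N) \<Rightarrow> real^'N^'n \<Rightarrow>
    (real^'n \<Rightarrow> real^'N) \<Rightarrow> (real^'N \<Rightarrow> real) \<Rightarrow> real^'n \<Rightarrow> real^'n^'n"
  where "L_mat F R Q E \<Phi> u =
    S_mat F Q E u ** gen_inv_matrix Q (calL_mat R \<Phi> E u) (transpose (S_mat F Q E u))"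

text \<open>For a spatial profile \<open>w\<close>, the first-order corrector \<open>U\<^sub>1\<close> is the solution of
  \<open>B(E(w)) U\<^sub>1 = - \<partial>\<^sub>x F(E(w))\<close>, \<open>Q U\<^sub>1 = 0\<close>.\<close>

definition corrector_rhs :: "(real^'N \<Rightarrow> real^'N) \<Rightarrow> (real^'n \<Rightarrow> real^'N) \<Rightarrow>
    (real \<Rightarrow> real^'n) \<Rightarrow> real \<Rightarrow> real^'N"
  where "corrector_rhs F E w x = - vector_derivative (\<lambda>y. F (E (w y))) (at x)"

definition corrector :: "(real^'N \<Rightarrow> real^'N) \<Rightarrow> (real^'N \<Rightarrow> real^'N) \<Rightarrow> real^'N^'n \<Rightarrow>
    (real^'n \<Rightarrow> real^'N) \<Rightarrow> (real \<Rightarrow> real^'n) \<Rightarrow> real \<Rightarrow> real^'N"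
  where "corrector F R Q E w x =
    (THE V. solves_constrained Q (jacobian R (at (E (w x)))) (corrector_rhs F E w x) V)"

definition effective_flux :: "(real^'N \<Rightarrow> real^'N) \<Rightarrow> (real^'N \<Rightarrow> real^'N) \<Rightarrow> real^'N^'n \<Rightarrow>
    (real^'n \<Rightarrow> real^'N) \<Rightarrow> (real \<Rightarrow> real^'n) \<Rightarrow> real \<Rightarrow> real^'n"
  where "effective_flux F R Q E w x =
    (Q ** jacobian F (at (E (w x)))) *v corrector F R Q E w x"

definition entropy_flux :: "(real^'N \<Rightarrow> real^'N) \<Rightarrow> (real^'N \<Rightarrow> real^'N) \<Rightarrow> real^'N^'n \<Rightarrow>
    (real^'n \<Rightarrow> real^'N) \<Rightarrow> (real^'N \<Rightarrow> real) \<Rightarrow> (real \<Rightarrow> real^'n) \<Rightarrow> real \<Rightarrow> real^'n"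
  where "entropy_flux F R Q E \<Phi> w x =
    L_mat F R Q E \<Phi> (w x) *v vector_derivative (\<lambda>y. grad (\<lambda>v. \<Phi> (E v)) (w y)) (at x)"

text \<open>\<open>\<partial>\<^sub>t u = \<partial>\<^sub>x G\<close> for \<open>t > 0\<close>, in the classical sense; both derivatives are required to exist.\<close>

definition evolves_by :: "(real \<Rightarrow> real \<Rightarrow> real^'n) \<Rightarrow> (real \<Rightarrow> real \<Rightarrow> real^'n) \<Rightarrow> bool"
  where "evolves_by u G \<longleftrightarrow> (\<forall>t>0. \<forall>x. \<exists>d.
    ((\<lambda>s. u s x) has_vector_derivative d) (at t) \<and>
    ((\<lambda>y. G t y) has_vector_derivative d) (at x))"

text \<open>The effective equations \<open>\<partial>\<^sub>t u = - \<partial>\<^sub>x (Q A(E(u)) U\<^sub>1)\<close> and their entropy form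
  \<open>\<partial>\<^sub>t u = \<partial>\<^sub>x (L(u) \<partial>\<^sub>x (D\<^sub>u \<Phi>(E(u)))\<^sup>T)\<close>.\<close>

definition effective_eqs :: "(real^'N \<Rightarrow> real^'N) \<Rightarrow> (real^'N \<Rightarrow> real^'N) \<Rightarrow> real^'N^'n \<Rightarrow>
    (real^'n \<Rightarrow> real^'N) \<Rightarrow> (real \<Rightarrow> real \<Rightarrow> real^'n) \<Rightarrow> bool"
  where "effective_eqs F R Q E u \<longleftrightarrow> evolves_by u (\<lambda>t x. - effective_flux F R Q E (u t) x)"

definition entropy_form_eqs :: "(real^'N \<Rightarrow> real^'N) \<Rightarrow> (real^'N \<Rightarrow> real^'N) \<Rightarrow> real^'N^'n \<Rightarrow>
    (real^'n \<Rightarrow> real^'N) \<Rightarrow> (real^'N \<Rightarrow> real) \<Rightarrow> (real \<Rightarrow> real \<Rightarrow> real^'n) \<Rightarrow> bool"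
  where "entropy_form_eqs F R Q E \<Phi> u \<longleftrightarrow> evolves_by u (\<lambda>t x. entropy_flux F R Q E \<Phi> (u t) x)"

end

theory Submission
  imports Defs
begin

text \<open>
  At an equilibrium \<open>\<E>(v)\<close> write \<open>H\<close> for the Hessian of \<open>\<Phi>\<close>, \<open>D\<close> for the derivative of \<open>\<E>\<close>.
  Since \<open>Q R = 0\<close>, the image of \<open>B\<close> lies in \<open>ker Q\<close>, and it equals \<open>ker Q\<close> by counting
  dimensions; as \<open>ker B\<close> meets it trivially, \<open>B\<close> restricts to a bijection of \<open>ker Q\<close>. Hence
  \<open>H B V = b\<close>, \<open>Q V = 0\<close> is uniquely solvable iff \<open>Q H\<^sup>-\<^sup>1 b = 0\<close>. Differentiating \<open>D\<Phi>(\<E>(v)) = \<nu> Q\<close>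
  shows that \<open>H D\<close> and \<open>Q\<^sup>T\<close> have the same range, and \<open>H A = A\<^sup>T H\<close> because \<open>D\<Phi> A\<close> is a
  gradient. So \<open>S\<^sup>T z = A\<^sup>T H D w = H A D w\<close> for some \<open>w\<close>, and \<open>Q A D w = 0\<close> is the derivative of
  \<open>Q F(\<E>(v)) = 0\<close>. The gradient of \<open>\<Phi> \<circ> \<E>\<close> is \<open>\<nu>\<close>; taking \<open>z = \<partial>\<^sub>x \<nu>\<close> gives
  \<open>Q\<^sup>T z = H D \<partial>\<^sub>x u\<close>, so the solution of \<open>\<L> V = S\<^sup>T z\<close>, \<open>Q V = 0\<close> is \<open>V = - U\<^sub>1\<close>.
\<close>

section \<open>Symmetry of second derivatives\<close>

text \<open>The mean value theorem in direction \<open>v\<close>, applied to the increment in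
  direction \<open>w\<close>, leaves a difference of two first derivatives; differentiability of
  \<open>\<lambda>y. f' y v\<close> at the single point \<open>x\<close> turns it into
  \<open>s * f'' w\<close> up to \<open>o(s)\<close>.\<close>

lemma second_difference_tendsto:
  fixes f :: "'a::real_normed_vector \<Rightarrow> real"
  assumes "open S" "x \<in> S"
    and f': "\<And>y. y \<in> S \<Longrightarrow> (f has_derivative f' y) (at y)"
    and f'': "((\<lambda>y. f' y v) has_derivative f'') (at x)"
  shows "((\<lambda>s. (f (x + s *\<^sub>R v + s *\<^sub>R w) - f (x + s *\<^sub>R v) - f (x + s *\<^sub>R w) + f x) / s\<^sup>2)
           \<longlongrightarrow> f'' w) (at_right 0)"
    (is "(?\<Delta> \<longlongrightarrow> _) _")
proof (rule tendstoI)
  fix e :: real assume "e > 0"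
  \<comment> \<open>The summand 1 keeps \<open>C\<close> positive and strictly above
    \<open>norm v + norm w\<close>, even if both vectors vanish.\<close>
  define C where "C = norm v + norm w + 1"
  have C: "C > 0" "norm v \<le> C" "norm w \<le> C" "norm v + norm w < C"
    unfolding C_def by (auto intro: add_nonneg_pos)
  \<comment> \<open>The factor 2 accounts for linearizing at two points, each at a cost of at most
    \<open>k * (s * (norm v + norm w))\<close>.\<close>
  define k where "k = e / (2 * C)"
  have "k > 0" using \<open>e > 0\<close> C by (simp add: k_def)
  interpret f'': bounded_linear f'' using f'' by (rule has_derivative_bounded_linear)
  obtain r where r: "r > 0" "ball x r \<subseteq> S"
    using assms(1,2) open_contains_ball by blast
  obtain d where d: "d > 0"
    "\<And>y. norm (y - x) < d \<Longrightarrow> norm (f' y v - f' x v - f'' (y - x)) \<le> k * norm (y - x)"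
    using f'' \<open>k > 0\<close> unfolding has_derivative_at_alt by blast
  \<comment> \<open>For \<open>s < m\<close> the parallelogram spanned at \<open>x\<close> by
    \<open>s v\<close> and \<open>s w\<close> stays inside \<open>S\<close> and inside the range of
    the estimate \<open>d(2)\<close>.\<close>
  define m where "m = min r d / C"
  have "m > 0" using r d C by (simp add: m_def)
  have "dist (?\<Delta> s) (f'' w) < e" if s: "0 < s" "s < m" for s
  proof -
    have small: "norm (\<tau> *\<^sub>R v + \<sigma> *\<^sub>R w) \<le> s * (norm v + norm w)"
      if "0 \<le> \<tau>" "\<tau> \<le> s" "0 \<le> \<sigma>" "\<sigma> \<le> s" for \<tau> \<sigma>
    proof -
      have "norm (\<tau> *\<^sub>R v + \<sigma> *\<^sub>R w) \<le> \<tau> * norm v + \<sigma> * norm w"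
        using norm_triangle_ineq[of "\<tau> *\<^sub>R v" "\<sigma> *\<^sub>R w"] that by simp
      also have "\<dots> \<le> s * norm v + s * norm w"
        using that by (intro add_mono mult_right_mono) auto
      finally show ?thesis by (simp add: distrib_left)
    qed
    have sC: "s * C < min r d"
      using s(2) C(1) by (simp add: m_def pos_less_divide_eq)
    have near: "norm (\<tau> *\<^sub>R v + \<sigma> *\<^sub>R w) < min r d"
      if "0 \<le> \<tau>" "\<tau> \<le> s" "0 \<le> \<sigma>" "\<sigma> \<le> s" for \<tau> \<sigma>
      using small[OF that] sC mult_strict_left_mono[OF C(4) s(1)] by linarith
    have inS: "x + \<tau> *\<^sub>R v + \<sigma> *\<^sub>R w \<in> S"
      if "0 \<le> \<tau>" "\<tau> \<le> s" "0 \<le> \<sigma>" "\<sigma> \<le> s" for \<tau> \<sigma>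
    proof -
      have "dist x (x + \<tau> *\<^sub>R v + \<sigma> *\<^sub>R w) = norm (\<tau> *\<^sub>R v + \<sigma> *\<^sub>R w)"
        by (metis add.assoc add_diff_cancel_left' dist_commute dist_norm)
      then show ?thesis using near[OF that] r(2) by auto
    qed
    \<comment> \<open>The second difference equals \<open>\<phi> s - \<phi> 0\<close>, so one
      application of the mean value theorem suffices.\<close>
    define \<phi> where "\<phi> \<tau> = f (x + \<tau> *\<^sub>R v + s *\<^sub>R w) - f (x + \<tau> *\<^sub>R v)" for \<tau>
    define \<phi>' where "\<phi>' \<tau> = f' (x + \<tau> *\<^sub>R v + s *\<^sub>R w) v - f' (x + \<tau> *\<^sub>R v) v" for \<tau>
    have "(\<phi> has_derivative (\<lambda>h. h * \<phi>' \<tau>)) (at \<tau> within {0..s})" if "0 \<le> \<tau>" "\<tau> \<le> s" for \<tau>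
    proof -
      have inS1: "x + \<tau> *\<^sub>R v + s *\<^sub>R w \<in> S" using inS[OF that, of s] s by simp
      have 1: "((\<lambda>\<tau>. f (x + \<tau> *\<^sub>R v + s *\<^sub>R w)) has_derivative
          (\<lambda>h. f' (x + \<tau> *\<^sub>R v + s *\<^sub>R w) (h *\<^sub>R v))) (at \<tau> within {0..s})"
        by (rule has_derivative_compose[where g=f and f="\<lambda>\<tau>. x + \<tau> *\<^sub>R v + s *\<^sub>R w", OF _ f'[OF inS1]]) (auto intro!: derivative_eq_intros)
      have in0: "x + \<tau> *\<^sub>R v \<in> S" using inS[OF that, of 0] s by simp
      have 2: "((\<lambda>\<tau>. f (x + \<tau> *\<^sub>R v)) has_derivative
          (\<lambda>h. f' (x + \<tau> *\<^sub>R v) (h *\<^sub>R v))) (at \<tau> within {0..s})"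
        by (rule has_derivative_compose[where g=f and f="\<lambda>\<tau>. x + \<tau> *\<^sub>R v", OF _ f'[OF in0]]) (auto intro!: derivative_eq_intros)
      have "linear (f' (x + \<tau> *\<^sub>R v + s *\<^sub>R w))" "linear (f' (x + \<tau> *\<^sub>R v))"
        using f'[OF inS[OF that, of s]] f'[OF in0] s by (auto dest: has_derivative_linear)
      then have "(\<lambda>h. f' (x + \<tau> *\<^sub>R v + s *\<^sub>R w) (h *\<^sub>R v) - f' (x + \<tau> *\<^sub>R v) (h *\<^sub>R v))
          = (\<lambda>h. h * \<phi>' \<tau>)"
        by (auto simp: \<phi>'_def linear_cmul algebra_simps)
      with has_derivative_diff[OF 1 2] show ?thesis unfolding \<phi>_def by simp
    qed
    from mvt_very_simple[OF less_imp_le[OF s(1)] this]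
    obtain \<tau> where \<tau>: "0 \<le> \<tau>" "\<tau> \<le> s" "\<phi> s - \<phi> 0 = s * \<phi>' \<tau>" by auto
    define y z where "y = x + \<tau> *\<^sub>R v + s *\<^sub>R w" and "z = x + \<tau> *\<^sub>R v"
    have y: "y - x = \<tau> *\<^sub>R v + s *\<^sub>R w" and z: "z - x = \<tau> *\<^sub>R v + 0 *\<^sub>R w"
      by (simp_all add: y_def z_def)
    have lin: "norm (f' p v - f' x v - f'' (p - x)) \<le> k * (s * (norm v + norm w))"
      if "p - x = \<tau> *\<^sub>R v + \<sigma> *\<^sub>R w" "0 \<le> \<sigma>" "\<sigma> \<le> s" for p \<sigma>
    proof (rule order_trans[OF d(2)])
      show "norm (p - x) < d" using near[OF \<tau>(1,2) that(2,3)] that(1) by simp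
      show "k * norm (p - x) \<le> k * (s * (norm v + norm w))"
        unfolding that(1) by (rule mult_left_mono[OF small[OF \<tau>(1,2) that(2,3)]]) (use \<open>k > 0\<close> in simp)
    qed
    have ny: "\<bar>f' y v - f' x v - f'' (y - x)\<bar> \<le> k * (s * (norm v + norm w))"
      using lin[OF y] s(1) by simp
    have nz: "\<bar>f' z v - f' x v - f'' (z - x)\<bar> \<le> k * (s * (norm v + norm w))"
      using lin[OF z] s(1) by simp
    \<comment> \<open>The common displacement \<open>\<tau> v\<close> cancels, so the unknown
      \<open>\<tau>\<close> leaves the main term.\<close>
    have "f'' (y - x) - f'' (z - x) = s * f'' w"
      by (simp add: y z f''.add f''.scaleR f''.zero)
    moreover have "\<phi>' \<tau> = f' y v - f' z v"
      by (simp add: \<phi>'_def y_def z_def)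
    ultimately have "\<bar>\<phi>' \<tau> - s * f'' w\<bar> \<le> 2 * k * (s * (norm v + norm w))"
      using ny nz by linarith
    also have "\<dots> < 2 * k * (s * C)"
      using C s \<open>k > 0\<close> by (intro mult_strict_left_mono) auto
    also have "\<dots> = s * e" using C by (simp add: k_def)
    finally have bd: "\<bar>\<phi>' \<tau> - s * f'' w\<bar> < s * e" .
    have "?\<Delta> s = (\<phi> s - \<phi> 0) / s\<^sup>2" by (simp add: \<phi>_def)
    also have "\<dots> = \<phi>' \<tau> / s" using \<tau>(3) s by (simp add: power2_eq_square)
    also have "\<dots> - f'' w = (\<phi>' \<tau> - s * f'' w) / s" using s by (simp add: diff_divide_distrib)
    finally have "dist (?\<Delta> s) (f'' w) = \<bar>\<phi>' \<tau> - s * f'' w\<bar> / s"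
      using s by (simp add: dist_real_def)
    with bd s show ?thesis by (simp add: pos_divide_less_eq mult.commute)
  qed
  then show "\<forall>\<^sub>F s in at_right 0. dist (?\<Delta> s) (f'' w) < e"
    using \<open>m > 0\<close> by (auto simp: eventually_at_right)
qed

text \<open>The second difference is symmetric in \<open>v\<close> and \<open>w\<close>, and its
  limit is unique. No continuity of the second derivative enters.\<close>

lemma second_derivative_symmetric:
  fixes f :: "'a::real_normed_vector \<Rightarrow> real"
  assumes "open S" "x \<in> S"
    and "\<And>y. y \<in> S \<Longrightarrow> (f has_derivative f' y) (at y)"
    and "\<And>v. ((\<lambda>y. f' y v) has_derivative f'' v) (at x)"
  shows "f'' v w = f'' w v"
proof (rule tendsto_unique[OF trivial_limit_at_right_real])
  let ?\<Delta> = "\<lambda>v w s. (f (x + s *\<^sub>R v + s *\<^sub>R w) - f (x + s *\<^sub>R v) - f (x + s *\<^sub>R w) + f x) / s\<^sup>2"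
  show "(?\<Delta> v w \<longlongrightarrow> f'' v w) (at_right 0)"
    by (rule second_difference_tendsto[OF assms])
  have "?\<Delta> v w = ?\<Delta> w v" by (simp add: algebra_simps)
  then show "(?\<Delta> v w \<longlongrightarrow> f'' w v) (at_right 0)"
    using second_difference_tendsto[OF assms, of w v] by simp
qed

section \<open>Solvability of the constrained linear system\<close>

text \<open>The kernel is the orthogonal complement of the row space.\<close>

lemma rank_plus_dim_kernel:
  fixes A :: "real^'n^'m"
  shows "rank A + dim {x. A *v x = 0} = CARD('n)"
proof -
  have "{y \<in> UNIV. \<forall>x\<in>span (rows A). orthogonal x y} = {x. A *v x = 0}"
  proof (intro set_eqI iffI)
    fix y assume "y \<in> {y \<in> UNIV. \<forall>x\<in>span (rows A). orthogonal x y}"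
    then have "\<forall>i. A $ i \<bullet> y = 0"
      by (auto simp: rows_def row_def orthogonal_def span_base intro!: span_base)
    then show "y \<in> {x. A *v x = 0}" by (simp add: matrix_mult_dot vec_eq_iff)
  next
    fix y assume "y \<in> {x. A *v x = 0}"
    then show "y \<in> {y \<in> UNIV. \<forall>x\<in>span (rows A). orthogonal x y}"
      using orthogonal_nullspace_rowspace[of A y] by (auto simp: orthogonal_commute)
  qed
  then show ?thesis
    using dim_subspace_orthogonal_to_vectors[of "span (rows A)" UNIV]
    by (simp add: row_rank_def)
qed

lemma kernel_subspace: "subspace {x. (A::real^'n^'m) *v x = 0}"
  by (simp add: subspace_def matrix_vector_right_distrib matrix_vector_mult_scaleR)

lemma solves_constrained_ex1_iff:
  fixes Q :: "real^'N^'n" and B :: "real^'N^'N"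
  assumes "rank Q = CARD('n)" and QB: "Q ** B = 0"
    and "dim {V. B *v V = 0} = CARD('n)"
    and ker: "{V. B *v V = 0} \<inter> range ((*v) B) = {0}"
  shows "(\<exists>!V. solves_constrained Q B b V) \<longleftrightarrow> Q *v b = 0"
proof -
  have QB0: "Q *v (B *v V) = 0" for V
    by (simp add: matrix_vector_mul_assoc QB)
  \<comment> \<open>Both sides are \<open>N - n\<close>, which upgrades the inclusion of the image
    of \<open>B\<close> in the kernel of \<open>Q\<close> to an equality.\<close>
  have "rank B = dim {V. Q *v V = 0}"
    using rank_plus_dim_kernel[of B] rank_plus_dim_kernel[of Q] assms(1,3) by linarith
  then have range: "range ((*v) B) = {V. Q *v V = 0}"
    using QB0 kernel_subspace[of Q]
    by (intro subspace_dim_equal) (auto simp: rank_dim_range linear_subspace_image)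
  have inj: "V = 0" if "B *v V = 0" "Q *v V = 0" for V
    using that ker range by blast
  \<comment> \<open>An injective endomorphism of the finite-dimensional kernel of \<open>Q\<close>
    is onto.\<close>
  have surj: "(*v) B ` {V. Q *v V = 0} = {V. Q *v V = 0}"
  proof (rule subspace_dim_equal)
    have "dim ((*v) B ` {V. Q *v V = 0}) = dim {V. Q *v V = 0}"
    proof (rule dim_image_eq)
      have sp: "span {V. Q *v V = 0} = {V. Q *v V = 0}" using kernel_subspace by (simp add: span_eq_iff)
      have "inj_on ((*v) B) {V. Q *v V = 0}"
      proof (rule inj_onI)
        fix V W assume "V \<in> {V. Q *v V = 0}" "W \<in> {V. Q *v V = 0}" "B *v V = B *v W"
        then show "V = W" using inj[of "V - W"] by (simp add: matrix_vector_mult_diff_distrib)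
      qed
      then show "inj_on ((*v) B) (span {V. Q *v V = 0})" by (simp only: sp)
    qed simp
    then show "dim {V. Q *v V = 0} \<le> dim ((*v) B ` {V. Q *v V = 0})" by simp
    show "subspace ((*v) B ` {V. Q *v V = 0})"
      by (rule linear_subspace_image[OF matrix_vector_mul_linear kernel_subspace])
    show "(*v) B ` {V. Q *v V = 0} \<subseteq> {V. Q *v V = 0}" using QB0 by blast
  qed (rule kernel_subspace)
  show ?thesis
  proof
    assume "\<exists>!V. solves_constrained Q B b V"
    then obtain V where "B *v V = b" unfolding solves_constrained_def by blast
    then show "Q *v b = 0" using QB0 by blast
  next
    assume "Q *v b = 0"
    then obtain V where V: "Q *v V = 0" "b = B *v V" using surj by blast
    show "\<exists>!V. solves_constrained Q B b V"
    proof (rule ex1I[of _ V])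
      show "solves_constrained Q B b V" using V by (simp add: solves_constrained_def)
      fix W assume "solves_constrained Q B b W"
      then have "B *v (W - V) = 0" "Q *v (W - V) = 0"
        using V by (simp_all add: solves_constrained_def matrix_vector_mult_diff_distrib)
      then show "W = V" using inj[of "W - V"] by simp
    qed
  qed
qed

lemma pos_definite_invertible:
  assumes "pos_definite H" shows "invertible H"
proof -
  have "H *v x \<noteq> 0" if "x \<noteq> 0" for x
    using assms that unfolding pos_definite_def by fastforce
  then show ?thesis
    by (metis invertible_left_inverse matrix_left_invertible_ker)
qed

lemma matrix_inv_mul_vector:
  fixes H :: "real^'n^'n"
  assumes "invertible H"
  shows "matrix_inv H *v (H *v x) = x" "H *v (matrix_inv H *v x) = x"
proof -
  have "H ** matrix_inv H = mat 1 \<and> matrix_inv H ** H = mat 1"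
    using assms unfolding matrix_inv_def invertible_def by (rule someI_ex)
  then show "matrix_inv H *v (H *v x) = x" "H *v (matrix_inv H *v x) = x"
    by (simp_all add: matrix_vector_mul_assoc)
qed

text \<open>Moves the Hessian to the right-hand side, which reduces the system for
  \<open>H B\<close> to the one for \<open>B\<close>.\<close>

lemma solves_constrained_mult_left:
  fixes H :: "real^'N^'N"
  assumes "invertible H"
  shows "solves_constrained Q (H ** B) b V \<longleftrightarrow> solves_constrained Q B (matrix_inv H *v b) V"
  unfolding solves_constrained_def matrix_vector_mul_assoc[symmetric]
  by (metis assms matrix_inv_mul_vector)

text \<open>The hypothesis at the basis vectors makes each column a genuine solution; both equations
  are linear, so the columns superpose.\<close>

lemma gen_inv_matrix_solves:
  fixes X :: "real^'k^'N"
  assumes "\<And>z. \<exists>!V. solves_constrained Q M (X *v z) V"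
  shows "solves_constrained Q M (X *v p) (gen_inv_matrix Q M X *v p)"
proof -
  have sol: "solves_constrained Q M (column j X) (gen_inv Q M (column j X))" for j
    unfolding gen_inv_def
    by (rule theI') (use assms[of "axis j 1"] in \<open>simp add: matrix_vector_mult_basis\<close>)
  have col: "column j (gen_inv_matrix Q M X) = gen_inv Q M (column j X)" for j
    by (simp add: column_def gen_inv_matrix_def vec_eq_iff)
  have lin: "C *v (gen_inv_matrix Q M X *v p) = (\<Sum>j\<in>UNIV. p $ j *\<^sub>R (C *v gen_inv Q M (column j X)))"
    for C :: "real^'N^'m"
    by (simp add: matrix_mult_sum[of "gen_inv_matrix Q M X"] col scalar_mult_eq_scaleR
        linear_sum[OF matrix_vector_mul_linear] matrix_vector_mult_scaleR)
  have X: "X *v p = (\<Sum>j\<in>UNIV. p $ j *\<^sub>R column j X)"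
    by (simp add: matrix_mult_sum[of X] scalar_mult_eq_scaleR)
  show ?thesis
    using sol by (simp add: solves_constrained_def lin X)
qed

section \<open>Gradients, Hessians and the entropy structure\<close>

lemma Ck_on_2_differentiable:
  assumes "Ck_on 2 f S" "open S" "x \<in> S"
  shows "f differentiable (at x)" "(\<lambda>y. frechet_derivative f (at y) v) differentiable (at x)"
  using assms by (auto simp: numeral_2_eq_2 differentiable_on_eq_differentiable_at)

lemma has_derivative_grad:
  assumes "f differentiable (at x)"
  shows "(f has_derivative (\<lambda>v. grad f x \<bullet> v)) (at x)"
proof -
  have lin: "linear (frechet_derivative f (at x))"
    using assms by (rule linear_frechet_derivative)
  have "frechet_derivative f (at x) v = grad f x \<bullet> v" for v
  proof -
    have "frechet_derivative f (at x) v = frechet_derivative f (at x) (\<Sum>i\<in>UNIV. v $ i *\<^sub>R axis i 1)"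
      using basis_expansion[of v] by (simp only: scalar_mult_eq_scaleR)
    also have "\<dots> = grad f x \<bullet> v"
      by (simp add: linear_sum[OF lin] linear_cmul[OF lin] grad_def inner_vec_def mult.commute)
    finally show ?thesis .
  qed
  then have "frechet_derivative f (at x) = (\<lambda>v. grad f x \<bullet> v)" ..
  then show ?thesis
    using assms by (simp only: frechet_derivative_works)
qed

lemma grad_eqI:
  assumes "(f has_derivative (\<lambda>v. g \<bullet> v)) (at x)"
  shows "grad f x = g"
  using frechet_derivative_at[OF assms, symmetric] by (simp add: grad_def vec_eq_iff inner_axis)

lemma has_derivative_grad_hessian:
  assumes "Ck_on 2 f S" "open S" "x \<in> S"
  shows "(grad f has_derivative (*v) (hessian f x)) (at x)"
proof -
  \<comment> \<open>Each component of the gradient is a directional derivative, which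
    \<open>Ck_on 2\<close> makes differentiable; the components are then assembled.\<close>
  have "((\<lambda>y. grad f y $ i) has_derivative frechet_derivative (\<lambda>y. grad f y $ i) (at x)) (at x)" for i
    using Ck_on_2_differentiable(2)[OF assms, of "axis i 1"]
    by (simp add: grad_def flip: frechet_derivative_works)
  then have "((\<lambda>y. grad f y \<bullet> b) has_derivative
      (\<lambda>h. (\<chi> i. frechet_derivative (\<lambda>y. grad f y $ i) (at x) h) \<bullet> b)) (at x)" if "b \<in> Basis" for b
    using that by (auto simp: Basis_vec_def inner_axis)
  then have "grad f differentiable (at x)"
    by (intro differentiableI) (auto simp: has_derivative_componentwise_within[of "grad f"])
  then show ?thesis
    unfolding hessian_def jacobian_works .
qed

text \<open>Serves to differentiate an identity that holds on an open set; the constraints on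
  \<open>Q\<close>, \<open>R\<close>, \<open>E\<close> and \<open>F\<close> are exploited this
  way.\<close>

lemma has_derivative_unique_on_open:
  assumes "(f has_derivative f') (at x)" "(g has_derivative g') (at x)"
    and "open S" "x \<in> S" "\<And>y. y \<in> S \<Longrightarrow> f y = g y"
  shows "f' = g'"
  using has_derivative_transform_within_open[OF assms(1,3,4,5)] assms(2) has_derivative_unique by blast

text \<open>Differentiating \<open>D\<Psi> = D\<Phi> A\<close> would produce a term with the second derivative of \<open>F\<close>.
  Passing to \<open>\<Psi> - c \<bullet> F\<close> with \<open>c = D\<Phi>(U)\<close> frozen removes it at the point \<open>U\<close>.\<close>

lemma entropy_hessian_symmetrizes:
  fixes F :: "real^'N \<Rightarrow> real^'N"
  assumes "open \<Omega>" "U \<in> \<Omega>" "Ck_on 2 F \<Omega>" "Ck_on 2 \<Phi> \<Omega>" "\<Psi> differentiable_on \<Omega>"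
    and compat: "\<forall>U\<in>\<Omega>. grad \<Phi> U v* jacobian F (at U) = grad \<Psi> U"
    and sym: "transpose (hessian \<Phi> U) = hessian \<Phi> U"
  shows "(hessian \<Phi> U *v w) v* jacobian F (at U) = hessian \<Phi> U *v (jacobian F (at U) *v w)"
proof -
  let ?H = "hessian \<Phi> U" and ?A = "jacobian F (at U)"
  \<comment> \<open>The derivative of \<open>\<Psi> - c \<bullet> F\<close> with
    \<open>c = grad \<Phi> U\<close>, once compatibility has expressed \<open>grad \<Psi> y\<close>
    through \<open>grad \<Phi> y\<close>.\<close>
  define f' where "f' = (\<lambda>y v. (grad \<Phi> y - grad \<Phi> U) \<bullet> frechet_derivative F (at y) v)"
  have dF: "(F has_derivative frechet_derivative F (at y)) (at y)" if "y \<in> \<Omega>" for y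
    using Ck_on_2_differentiable(1)[OF assms(3,1) that] by (simp flip: frechet_derivative_works)
  have jac: "frechet_derivative F (at y) v = jacobian F (at y) *v v" if "y \<in> \<Omega>" for y v
    using dF[OF that] by (simp add: jacobian_def has_derivative_linear)
  have f': "((\<lambda>y. \<Psi> y - grad \<Phi> U \<bullet> F y) has_derivative f' y) (at y)" if y: "y \<in> \<Omega>" for y
  proof -
    have "(\<Psi> has_derivative (\<lambda>v. grad \<Psi> y \<bullet> v)) (at y)"
      using assms(1,5) y by (intro has_derivative_grad) (simp add: differentiable_on_eq_differentiable_at)
    moreover have "grad \<Psi> y \<bullet> v = grad \<Phi> y \<bullet> frechet_derivative F (at y) v" for v
      using compat y by (metis dot_lmul_matrix jac)
    ultimately have "(\<Psi> has_derivative (\<lambda>v. grad \<Phi> y \<bullet> frechet_derivative F (at y) v)) (at y)"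
      by simp
    from has_derivative_diff[OF this has_derivative_inner_right[OF dF[OF y], of "grad \<Phi> U"]]
    show ?thesis by (simp add: f'_def inner_diff_left)
  qed
  \<comment> \<open>The factor \<open>grad \<Phi> y - grad \<Phi> U\<close> vanishes at
    \<open>y = U\<close>, so the product rule leaves no contribution from \<open>G\<close>.\<close>
  have f'': "((\<lambda>y. f' y v) has_derivative (\<lambda>w. (?H *v w) \<bullet> (?A *v v))) (at U)" for v
  proof -
    obtain G where G: "((\<lambda>y. frechet_derivative F (at y) v) has_derivative G) (at U)"
      using Ck_on_2_differentiable(2)[OF assms(3,1,2)] unfolding differentiable_def by metis
    have "((\<lambda>y. grad \<Phi> y - grad \<Phi> U) has_derivative (*v) ?H) (at U)"
      using has_derivative_diff[OF has_derivative_grad_hessian[OF assms(4,1,2)] has_derivative_const]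
      by simp
    from has_derivative_inner[OF this G] show ?thesis
      by (simp add: f'_def jac[OF assms(2)])
  qed
  \<comment> \<open>Together with the symmetry of \<open>?H\<close>, this is
    \<open>H A = A\<^sup>T H\<close>.\<close>
  have comm: "(?H *v w) \<bullet> (?A *v v) = (?H *v v) \<bullet> (?A *v w)" for v
    using second_derivative_symmetric[OF assms(1,2) f' f''] by metis
  show ?thesis
  proof (rule vector_eq_ldot[THEN iffD1], rule allI)
    fix v
    have "v \<bullet> ((?H *v w) v* ?A) = (?H *v v) \<bullet> (?A *v w)"
      by (metis comm dot_lmul_matrix inner_commute)
    also have "\<dots> = v \<bullet> (?H *v (?A *v w))"
      by (metis sym dot_lmul_matrix transpose_matrix_vector)
    finally show "v \<bullet> ((?H *v w) v* ?A) = v \<bullet> (?H *v (?A *v w))" .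
  qed
qed

text \<open>By \<open>fac\<close>, \<open>H D = Q\<^sup>T N\<close> with the square matrix
  \<open>N = K H D\<close>. If \<open>N w = 0\<close>, then \<open>H D w = 0\<close> and so
  \<open>w = Q D w = 0\<close>; hence \<open>N\<close> is onto, and any \<open>w\<close> with
  \<open>N w = z\<close> works.\<close>

lemma range_transpose_factor:
  fixes Q :: "real^'N^'n" and K :: "real^'N^'n" and D :: "real^'n^'N"
  assumes "invertible H" and QD: "\<And>w. Q *v (D *v w) = w"
    and fac: "\<And>w. H *v (D *v w) = (K *v (H *v (D *v w))) v* Q"
  obtains w where "z v* Q = H *v (D *v w)"
proof -
  let ?N = "K ** H ** D"
  have N: "?N *v w = K *v (H *v (D *v w))" for w
    by (simp add: matrix_vector_mul_assoc matrix_mul_assoc)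
  have "w = 0" if "?N *v w = 0" for w
  proof -
    have "H *v (D *v w) = 0"
      using fac[of w] that by (simp add: N)
    then have "D *v w = 0"
      by (metis assms(1) matrix_inv_mul_vector(1) matrix_vector_mult_0_right)
    then show "w = 0" using QD[of w] by simp
  qed
  then have "surj ((*v) ?N)"
    by (metis matrix_left_invertible_ker matrix_left_right_inverse matrix_right_invertible_surjective)
  then obtain w where "z = ?N *v w" by blast
  then show ?thesis using that fac[of w] N by simp
qed

section \<open>The effective equations and their entropy form\<close>

theorem theorem2p4:
  fixes \<Omega> :: "(real^'N) set"
    and F R :: "real^'N \<Rightarrow> real^'N"
    and Q :: "real^'N^'n"
    and \<omega> :: "(real^'n) set"
    and E :: "real^'n \<Rightarrow> real^'N"
    and \<Phi> \<Psi> :: "real^'N \<Rightarrow> real"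
    and \<nu> :: "real^'N \<Rightarrow> real^'n"
    and u :: "real \<Rightarrow> real \<Rightarrow> real^'n"
  assumes "convex \<Omega>" and "open \<Omega>"
    and "smooth_on F \<Omega>" and "smooth_on R \<Omega>"
    and "\<forall>U\<in>\<Omega>. has_real_eigenbasis (jacobian F (at U))"
    and "CARD('n) < CARD('N)" and "rank Q = CARD('n)"
    and "\<forall>U\<in>\<Omega>. Q *v R U = 0"
    and "\<omega> = (\<lambda>U. Q *v U) ` \<Omega>"
    and "\<forall>v\<in>\<omega>. E v \<in> \<Omega> \<and> R (E v) = 0 \<and> Q *v E v = v"
    and "E differentiable_on \<omega>"
    and "\<forall>v\<in>\<omega>. Q *v F (E v) = 0"
    and "\<forall>v\<in>\<omega>. dim {V. jacobian R (at (E v)) *v V = 0} = CARD('n)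
               \<and> {V. jacobian R (at (E v)) *v V = 0} \<inter> range (\<lambda>V. jacobian R (at (E v)) *v V) = {0}"
    and "Ck_on 2 \<Phi> \<Omega>" and "\<Psi> differentiable_on \<Omega>"
    and "\<forall>U\<in>\<Omega>. grad \<Phi> U v* jacobian F (at U) = grad \<Psi> U"
    and "\<forall>v\<in>\<omega>. pos_definite (hessian \<Phi> (E v))"
    and "\<forall>U\<in>\<Omega>. grad \<Phi> U \<bullet> R U \<ge> 0"
    and "\<forall>v\<in>\<omega>. grad \<Phi> (E v) = \<nu> (E v) v* Q"
    and "\<forall>t>0. \<forall>x. u t x \<in> \<omega>"
    and "\<forall>t>0. u t differentiable_on UNIV"
  shows
    "(\<forall>v\<in>\<omega>. (\<forall>b. (\<exists>!V. solves_constrained Q (calL_mat R \<Phi> E v) b V)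
                   \<longleftrightarrow> Q *v (matrix_inv (hessian \<Phi> (E v)) *v b) = 0)
            \<and> (\<forall>z. \<exists>!V. solves_constrained Q (calL_mat R \<Phi> E v) (transpose (S_mat F Q E v) *v z) V))
     \<and> (\<forall>t>0. \<forall>x. (\<exists>!V. solves_constrained Q (jacobian R (at (E (u t x)))) (corrector_rhs F E (u t) x) V)
            \<and> (\<lambda>y. grad (\<lambda>v. \<Phi> (E v)) (u t y)) differentiable (at x)
            \<and> - effective_flux F R Q E (u t) x = entropy_flux F R Q E \<Phi> (u t) x)
     \<and> (effective_eqs F R Q E u \<longleftrightarrow> entropy_form_eqs F R Q E \<Phi> u)"
proof -
  note \<Omega> = assms(2) and F = assms(3) and R = assms(4) and rank = assms(7) and QR = assms(8)
    and \<omega> = assms(9) and E = assms(10) and diffE = assms(11) and QF = assms(12) and kerB = assms(13)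
    and \<Phi> = assms(14) and \<Psi> = assms(15) and compat = assms(16) and pd = assms(17)
    and \<nu> = assms(19) and u = assms(20) and diffu = assms(21)
  let ?A = "\<lambda>v. jacobian F (at (E v))" and ?B = "\<lambda>v. jacobian R (at (E v))"
    and ?H = "\<lambda>v. hessian \<Phi> (E v)" and ?D = "\<lambda>v. jacobian E (at v)"
  \<comment> \<open>Full row rank makes \<open>Q\<close> an open map; identities on
    \<open>\<omega>\<close> can then be differentiated.\<close>
  have "open \<omega>"
    unfolding \<omega> using \<Omega> rank
    by (intro open_surjective_linear_image) (auto simp: full_rank_surjective)
  have Ck: "Ck_on 2 F \<Omega>" "Ck_on 2 R \<Omega>" using F R by (auto simp: smooth_on_def)
  \<comment> \<open>A left inverse \<open>K\<close> of \<open>Q\<^sup>T\<close> recovers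
    \<open>\<nu>\<close> as \<open>K *v grad \<Phi>\<close> on the equilibrium manifold, an
    expression that is differentiable along \<open>E\<close>.\<close>
  have "rank (transpose Q) = CARD('n)" by (simp add: rank_transpose rank)
  then obtain K :: "real^'N^'n" where "K ** transpose Q = mat 1"
    unfolding full_rank_injective matrix_left_invertible_injective[symmetric] by blast
  then have K: "K *v (z v* Q) = z" for z
    by (metis matrix_vector_mul_assoc matrix_vector_mul_lid transpose_matrix_vector)
  have dE: "(E has_derivative (*v) (?D v)) (at v)" if "v \<in> \<omega>" for v
    using diffE \<open>open \<omega>\<close> that by (simp add: differentiable_on_eq_differentiable_at flip: jacobian_works)
  have dF: "(F has_derivative (*v) (?A v)) (at (E v))" if "v \<in> \<omega>" for v
    using Ck_on_2_differentiable(1)[OF Ck(1) \<Omega>] E that by (simp flip: jacobian_works)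
  have dR: "(R has_derivative (*v) (?B v)) (at (E v))" if "v \<in> \<omega>" for v
    using Ck_on_2_differentiable(1)[OF Ck(2) \<Omega>] E that by (simp flip: jacobian_works)
  have dgrad: "(grad \<Phi> has_derivative (*v) (?H v)) (at (E v))" if "v \<in> \<omega>" for v
    using has_derivative_grad_hessian[OF \<Phi> \<Omega>] E that by simp
  have dmul: "((\<lambda>y. M *v f y) has_derivative (\<lambda>h. M *v f' h)) net"
    if "(f has_derivative f') net" for M :: "real^'a^'b" and f and f' :: "'c::real_normed_vector \<Rightarrow> _" and net
    using that by (rule bounded_linear.has_derivative[OF matrix_vector_mul_bounded_linear])
  have dFE: "((\<lambda>v. F (E v)) has_derivative (\<lambda>w. ?A v *v (?D v *v w))) (at v)" if "v \<in> \<omega>" for v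
    using diff_chain_at[OF dE[OF that] dF[OF that]] by (simp add: o_def)
  have dgE: "((\<lambda>v. grad \<Phi> (E v)) has_derivative (\<lambda>w. ?H v *v (?D v *v w))) (at v)" if "v \<in> \<omega>" for v
    using diff_chain_at[OF dE[OF that] dgrad[OF that]] by (simp add: o_def)

  have QD: "Q *v (?D v *v w) = w" if "v \<in> \<omega>" for v w
    using has_derivative_unique_on_open[OF dmul[OF dE[OF that]] has_derivative_ident \<open>open \<omega>\<close> that] E
    by (auto dest: fun_cong)
  have QAD: "Q *v (?A v *v (?D v *v w)) = 0" if "v \<in> \<omega>" for v w
    using has_derivative_unique_on_open[OF dmul[OF dFE[OF that]] has_derivative_const \<open>open \<omega>\<close> that] QF
    by (auto dest: fun_cong)
  have QB: "Q ** ?B v = 0" if "v \<in> \<omega>" for v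
  proof -
    have "Q *v (?B v *v w) = 0" for w
      using has_derivative_unique_on_open[OF dmul[OF dR[OF that]] has_derivative_const \<Omega>] QR E that
      by (metis (no_types, lifting))
    then show ?thesis by (simp add: matrix_eq matrix_vector_mul_assoc)
  qed
  \<comment> \<open>This is the derivative of
    \<open>grad \<Phi> (E v) = Q\<^sup>T K grad \<Phi> (E v)\<close>, in which \<open>\<nu>\<close>
    no longer appears.\<close>
  have HD: "?H v *v (?D v *v w) = (K *v (?H v *v (?D v *v w))) v* Q" if "v \<in> \<omega>" for v w
  proof -
    have "(\<lambda>w. ?H v *v (?D v *v w)) = (\<lambda>w. transpose Q *v (K *v (?H v *v (?D v *v w))))"
      using \<nu> K
      by (intro has_derivative_unique_on_open[OF dgE[OF that] dmul[OF dmul[OF dgE[OF that]]] \<open>open \<omega>\<close> that])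
        simp
    then show ?thesis by (auto dest: fun_cong)
  qed
  have inv: "invertible (?H v)" if "v \<in> \<omega>" for v
    using pd pos_definite_invertible that by blast
  have sym: "(?H v *v w) v* ?A v = ?H v *v (?A v *v w)" if "v \<in> \<omega>" for v w
    using entropy_hessian_symmetrizes[OF \<Omega> _ Ck(1) \<Phi> \<Psi> compat] E pd that
    by (simp add: pos_definite_def)
  have S: "transpose (S_mat F Q E v) *v z = (z v* Q) v* ?A v" for v z
    by (simp add: S_mat_def vector_matrix_mul_assoc)

  have solvable_B: "(\<exists>!V. solves_constrained Q (?B v) b V) \<longleftrightarrow> Q *v b = 0" if "v \<in> \<omega>" for v b
    using solves_constrained_ex1_iff[OF rank QB[OF that]] kerB that by blast
  have solvable_calL: "(\<exists>!V. solves_constrained Q (calL_mat R \<Phi> E v) b V)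
      \<longleftrightarrow> Q *v (matrix_inv (?H v) *v b) = 0" if "v \<in> \<omega>" for v b
    unfolding calL_mat_def solves_constrained_mult_left[OF inv[OF that]] by (rule solvable_B[OF that])
  have solvable_S: "\<exists>!V. solves_constrained Q (calL_mat R \<Phi> E v) (transpose (S_mat F Q E v) *v z) V"
    if v: "v \<in> \<omega>" for v z
  proof -
    obtain w where "z v* Q = ?H v *v (?D v *v w)"
      using range_transpose_factor[OF inv[OF v] QD[OF v] HD[OF v]] .
    then show ?thesis
      unfolding solvable_calL[OF v] S by (simp add: sym[OF v] matrix_inv_mul_vector inv[OF v] QAD[OF v])
  qed

  \<comment> \<open>The chain rule gives \<open>D\<^sup>T Q\<^sup>T \<nu>\<close>, which is
    \<open>\<nu>\<close> because \<open>Q D\<close> is the identity.\<close>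
  have grad_eta: "grad (\<lambda>v. \<Phi> (E v)) v = K *v grad \<Phi> (E v)" if v: "v \<in> \<omega>" for v
  proof (rule grad_eqI)
    have "(\<Phi> has_derivative (\<lambda>w. grad \<Phi> (E v) \<bullet> w)) (at (E v))"
      using E v by (intro has_derivative_grad Ck_on_2_differentiable(1)[OF \<Phi> \<Omega>]) auto
    from diff_chain_at[OF dE[OF v] this]
    have "((\<lambda>v. \<Phi> (E v)) has_derivative (\<lambda>w. grad \<Phi> (E v) \<bullet> (?D v *v w))) (at v)"
      by (simp add: o_def)
    moreover have "grad \<Phi> (E v) \<bullet> (?D v *v w) = (K *v grad \<Phi> (E v)) \<bullet> w" for w
      using \<nu> v by (simp add: K dot_lmul_matrix QD)
    ultimately show "((\<lambda>v. \<Phi> (E v)) has_derivative (\<lambda>w. (K *v grad \<Phi> (E v)) \<bullet> w)) (at v)" by simp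
  qed

  have pointwise: "(\<exists>!V. solves_constrained Q (?B (u t x)) (corrector_rhs F E (u t) x) V)
      \<and> (\<lambda>y. grad (\<lambda>v. \<Phi> (E v)) (u t y)) differentiable (at x)
      \<and> - effective_flux F R Q E (u t) x = entropy_flux F R Q E \<Phi> (u t) x"
    if "t > 0" for t x
  proof -
    define v where "v = u t x"
    have u\<omega>: "u t y \<in> \<omega>" for y using u \<open>t > 0\<close> by blast
    then have v: "v \<in> \<omega>" by (simp add: v_def)
    define w where "w = vector_derivative (u t) (at x)"
    have du: "(u t has_vector_derivative w) (at x)"
      using diffu \<open>t > 0\<close> by (simp add: differentiable_on_def w_def flip: vector_derivative_works)
    have chain: "((\<lambda>y. f (u t y)) has_vector_derivative f' w) (at x)"
      if "(f has_derivative f') (at v)" for f f'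
      using vector_derivative_diff_chain_within[OF du has_derivative_at_withinI] that
      by (simp add: v_def o_def)
    have rhs: "corrector_rhs F E (u t) x = - (?A v *v (?D v *v w))"
      unfolding corrector_rhs_def using vector_derivative_at[OF chain[OF dFE[OF v]]] by simp
    have ex1: "\<exists>!V. solves_constrained Q (?B v) (corrector_rhs F E (u t) x) V"
      unfolding solvable_B[OF v] rhs using QAD[OF v] by (simp add: vec.neg)
    \<comment> \<open>The \<open>x\<close>-derivative of \<open>\<nu>(E(u))\<close>, written through
      \<open>K\<close>.\<close>
    define p where "p = K *v (?H v *v (?D v *v w))"
    have p: "p v* Q = ?H v *v (?D v *v w)"
      using HD[OF v] by (simp add: p_def)
    have dp: "((\<lambda>y. grad (\<lambda>v. \<Phi> (E v)) (u t y)) has_vector_derivative p) (at x)"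
      using chain[OF dmul[OF dgE[OF v]], of K] by (simp add: grad_eta u\<omega> p_def)
    let ?V = "gen_inv_matrix Q (calL_mat R \<Phi> E v) (transpose (S_mat F Q E v)) *v p"
    have "solves_constrained Q (calL_mat R \<Phi> E v) (transpose (S_mat F Q E v) *v p) ?V"
      by (rule gen_inv_matrix_solves) (rule solvable_S[OF v])
    \<comment> \<open>Here \<open>S\<^sup>T p = H A D w\<close>, so cancelling \<open>H\<close>
      leaves \<open>A D w\<close>, the negative of the right-hand side of the corrector
      problem.\<close>
    then have "solves_constrained Q (?B v) (?A v *v (?D v *v w)) ?V"
      unfolding calL_mat_def solves_constrained_mult_left[OF inv[OF v]] S p sym[OF v]
        matrix_inv_mul_vector(1)[OF inv[OF v]] .
    then have "solves_constrained Q (?B v) (corrector_rhs F E (u t) x) (- ?V)"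
      by (simp add: solves_constrained_def rhs vec.neg)
    then have "corrector F R Q E (u t) x = - ?V"
      unfolding corrector_def v_def[symmetric] by (rule the1_equality[OF ex1])
    then have "- effective_flux F R Q E (u t) x = (Q ** ?A v) *v ?V"
      by (simp add: effective_flux_def v_def[symmetric] vec.neg)
    also have "\<dots> = entropy_flux F R Q E \<Phi> (u t) x"
      unfolding entropy_flux_def vector_derivative_at[OF dp] L_mat_def S_mat_def v_def[symmetric]
      by (simp add: matrix_vector_mul_assoc)
    finally show ?thesis
      using ex1 differentiableI_vector[OF dp] by (simp add: v_def)
  qed
  \<comment> \<open>For each \<open>t > 0\<close> the two fluxes agree as functions of
    \<open>x\<close>, so existence and value of their derivatives agree as well.\<close>
  have "effective_eqs F R Q E u \<longleftrightarrow> entropy_form_eqs F R Q E \<Phi> u"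
    unfolding effective_eqs_def entropy_form_eqs_def evolves_by_def using pointwise by simp
  with solvable_calL solvable_S pointwise show ?thesis by blast
qed

end
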